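(* Let $\mathcal{D}=\partial_xx+(A-1)x$ and $\mathcal{C}=Ax-J$, and suppose that the adjoint $\mathcal{D}^\dagger$ of $\mathcal{D}$ with respect to $W=W^{(\nu)}_\phi$ satisfies $$\mathcal{D}^\dagger=-\mathcal{D}+\mathcal{C}+v'(x)$$ for some scalar polynomial $v$ of degree $k$. Let $X(n)$ and $Y(n)$ be the coefficients of $x^{n-1}$ and $x^{n-2}$ in $P(x,n)$, respectively. Then the monic matrix valued orthogonal polynomials $P(x,n)$ for $W$ satisfy $$P\cdot\mathcal{D}=M\cdot P,\qquad M=\sum_{j=-k+1}^{1}A_j(n)\,\delta^j,$$ with $$A_1(n)=A-1,\qquad A_0(n)=n+X(n)A-AX(n+1)-B(n),$$ $$A_{-1}(n)=(n-1)X(n)+Y(n)(A-1)-(A-1)Y(n+1)-A_0(n)X(n),$$ $$A_j(n)=(v'(L))_j(n),\qquad -k+1\le j<-1,$$ where $B(n)=X(n)-X(n+1)$ and $(v'(L))_j(n)$ denotes the coefficient of $\delta^j$ in the difference operator $v'(L)$.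
   Context: Let $N\ge1$, $\nu>0$, let $a_1,\dots,a_{N-1}$ be real, let $E_{i,j}$ be the matrix units, and put $J=\sum_{k=1}^N kE_{k,k}$, $A=\sum_{k=1}^{N-1}a_kE_{k+1,k}$. Let $\phi$ be analytic on a neighbourhood of $[0,\infty)$, real valued on $[0,\infty)$, let $\delta^{(\nu)}_1,\dots,\delta_N^{(\nu)}>0$, and $$W^{(\nu)}_\phi(x)=e^{Ax}\,T^{(\nu)}_\phi(x)\,e^{A^*x},\qquad T^{(\nu)}_\phi(x)=e^{-\phi(x)}\sum_{k=1}^N\delta_k^{(\nu)}x^{\nu+k}E_{k,k},\qquad x\in[0,\infty).$$ It is assumed that $W^{(\nu)}_\phi$ has finite moments of all orders and that $W^{(\nu)}_\phi(x)P(x)$ tends to $0$ as $x\to0$ and $x\to\infty$ for every matrix polynomial $P$. Put $\langle P,Q\rangle=\int_0^\infty P(x)W^{(\nu)}_\phi(x)Q(x)^*\,dx$; $(P(x,n))_{n\ge0}$ is the unique sequence of monic polynomials of degree $n$ in $M_N(\mathbb{C})[x]$ with $\langle P(x,n),P(x,m)\rangle=\delta_{n,m}\mathcal{H}(n)$, $\mathcal{H}(n)$ positive definite. The adjoint means $\langle P\cdot\mathcal{D},Q\rangle=\langle P,Q\cdot\mathcal{D}^\dagger\rangle$ for all matrix polynomials; for this weight $\mathcal{D}^\dagger=-\partial_xx-(1+\nu+J)+x\phi'(x)-x$. The polynomials satisfy $xP(x,n)=P(x,n+1)+B(n)P(x,n)+C(n)P(x,n-1)$ with $C(n)=\mathcal{H}(n)\mathcal{H}(n-1)^{-1}$,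 i.e. $P\cdot x=L\cdot P$ with $L=\delta+B(n)+C(n)\delta^{-1}$. Differential operators act from the right: $P\cdot\sum_j\partial_x^jF_j(x)=\sum_jP^{(j)}(x)F_j(x)$. Difference operators act from the left: $(\sum_jA_j(n)\delta^j\cdot P)(x,n)=\sum_jA_j(n)P(x,n+j)$, with $P(x,m)=0$ for $m<0$; their product is composition. Coefficients of negative powers of $x$ are zero. Scalars denote multiples of the identity matrix.
   Formalization: For k=1 the sum defining M also includes the term A_{-1}(n)δ^{-1}, since without it the claim is false (e.g. N=1, φ(x)=2x, where A_{-1}(n)=C(n)≠0); for k≥2 the statement is unchanged. *)

theory Defs
  imports "HOL-Analysis.Analysis" "HOL-Computational_Algebra.Polynomial"
begin

(* The N x N matrices are indexed by a finite linear order 'n with N = CARD('n) elements.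
   The product of matrices is ** and the identity is mat 1; the operations * and 1 of the
   vector type act entrywise and are not used. *)

type_synonym 'n cmat = "complex^'n^'n"

(* M_N(C)[x], identified with M_N(C[x]). *)
type_synonym 'n mpoly = "complex poly^'n^'n"

(* sum_j d_x^j F_j(x) is represented by the polynomial in d_x whose j-th coefficient is F_j.
   Only the additive structure of the outer polynomial type is meaningful here. *)
type_synonym 'n diffop = "(complex poly^'n^'n) poly"

(* S j n is the coefficient of delta^j at n, where n ranges over the natural numbers. *)
type_synonym 'n shiftop = "int \<Rightarrow> nat \<Rightarrow> complex^'n^'n"


section \<open>Matrices\<close>

definition mstar :: "'n::finite cmat \<Rightarrow> 'n cmat" where
  "mstar M = (\<chi> i j. cnj (M $ j $ i))"

definition posdef :: "'n::finite cmat \<Rightarrow> bool" where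
  "posdef H \<longleftrightarrow> mstar H = H \<and>
     (\<forall>u. u \<noteq> 0 \<longrightarrow> 0 < Re (\<Sum>i\<in>UNIV. \<Sum>j\<in>UNIV. cnj (u $ i) * H $ i $ j * u $ j))"

definition mexp :: "'n::finite cmat \<Rightarrow> 'n cmat" where
  "mexp M = (\<Sum>k. (1 / fact k) *\<^sub>R (((**) M ^^ k) (mat 1)))"

(* card {..i} is the position of the index i, between 1 and N. *)
definition mat_unit :: "nat \<Rightarrow> nat \<Rightarrow> ('n::{finite,linorder}) cmat" where
  "mat_unit k l = (\<chi> i j. if card {..i} = k \<and> card {..j} = l then 1 else 0)"

definition J_mat :: "('n::{finite,linorder}) cmat" where
  "J_mat = (\<Sum>k=1..CARD('n). real k *\<^sub>R mat_unit k k)"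

definition A_mat :: "(nat \<Rightarrow> real) \<Rightarrow> ('n::{finite,linorder}) cmat" where
  "A_mat a = (\<Sum>k=1..CARD('n)-1. a k *\<^sub>R mat_unit (k + 1) k)"


section \<open>Matrix polynomials and differential operators\<close>

definition mconst :: "'n::finite cmat \<Rightarrow> 'n mpoly" where
  "mconst M = (\<chi> i j. [:M $ i $ j:])"

definition xpoly :: "'n::finite mpoly" where
  "xpoly = mat [:0, 1:]"

definition meval :: "'n::finite mpoly \<Rightarrow> complex \<Rightarrow> 'n cmat" where
  "meval P x = (\<chi> i j. poly (P $ i $ j) x)"

definition mcoeff :: "'n::finite mpoly \<Rightarrow> int \<Rightarrow> 'n cmat" where
  "mcoeff P m = (if m < 0 then 0 else (\<chi> i j. coeff (P $ i $ j) (nat m)))"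

definition mderiv :: "'n::finite mpoly \<Rightarrow> 'n mpoly" where
  "mderiv P = (\<chi> i j. pderiv (P $ i $ j))"

definition monic_of_degree :: "nat \<Rightarrow> 'n::finite mpoly \<Rightarrow> bool" where
  "monic_of_degree n P \<longleftrightarrow> mcoeff P (int n) = mat 1 \<and> (\<forall>m > int n. mcoeff P m = 0)"

definition diffop_act :: "'n::finite mpoly \<Rightarrow> 'n diffop \<Rightarrow> 'n mpoly" where
  "diffop_act P D = (\<Sum>j\<le>degree D. (mderiv ^^ j) P ** coeff D j)"


section \<open>The weight and its orthogonal polynomials\<close>

definition T_weight ::
  "real \<Rightarrow> (complex \<Rightarrow> complex) \<Rightarrow> (nat \<Rightarrow> real) \<Rightarrow> real \<Rightarrow> ('n::{finite,linorder}) cmat" where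
  "T_weight \<nu> \<phi> \<delta> x =
     mat (exp (- \<phi> (of_real x))) ** (\<Sum>k=1..CARD('n). (\<delta> k * x powr (\<nu> + real k)) *\<^sub>R mat_unit k k)"

definition W_weight ::
  "(nat \<Rightarrow> real) \<Rightarrow> real \<Rightarrow> (complex \<Rightarrow> complex) \<Rightarrow> (nat \<Rightarrow> real) \<Rightarrow> real \<Rightarrow> ('n::{finite,linorder}) cmat" where
  "W_weight a \<nu> \<phi> \<delta> x =
     mexp (x *\<^sub>R A_mat a) ** T_weight \<nu> \<phi> \<delta> x ** mexp (x *\<^sub>R mstar (A_mat a))"

definition finite_moments :: "(real \<Rightarrow> 'n::finite cmat) \<Rightarrow> bool" where
  "finite_moments W \<longleftrightarrow> (\<forall>m::nat. set_integrable lborel {0..} (\<lambda>x. x ^ m *\<^sub>R W x))"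

definition vanishes_at_ends :: "(real \<Rightarrow> 'n::finite cmat) \<Rightarrow> bool" where
  "vanishes_at_ends W \<longleftrightarrow> (\<forall>P.
     ((\<lambda>x. W x ** meval P (of_real x)) \<longlongrightarrow> 0) (at_right 0) \<and>
     ((\<lambda>x. W x ** meval P (of_real x)) \<longlongrightarrow> 0) at_top)"

definition mip :: "(real \<Rightarrow> 'n::finite cmat) \<Rightarrow> 'n mpoly \<Rightarrow> 'n mpoly \<Rightarrow> 'n cmat" where
  "mip W P Q =
     (LINT x:{0..}|lborel. meval P (of_real x) ** W x ** mstar (meval Q (of_real x)))"

definition is_adjoint :: "(real \<Rightarrow> 'n::finite cmat) \<Rightarrow> 'n diffop \<Rightarrow> 'n diffop \<Rightarrow> bool" where
  "is_adjoint W D D' \<longleftrightarrow> (\<forall>P Q. mip W (diffop_act P D) Q = mip W P (diffop_act Q D'))"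

definition monic_orthogonal :: "(real \<Rightarrow> 'n::finite cmat) \<Rightarrow> (nat \<Rightarrow> 'n mpoly) \<Rightarrow> bool" where
  "monic_orthogonal W P \<longleftrightarrow>
     (\<forall>n. monic_of_degree n (P n)) \<and>
     (\<forall>n m. n \<noteq> m \<longrightarrow> mip W (P n) (P m) = 0) \<and>
     (\<forall>n. posdef (mip W (P n) (P n)))"


section \<open>Difference operators\<close>

(* The operators act on sequences over the natural numbers, extended by 0 to negative indices,
   so terms with n + i < 0 are dropped both in the action and in the composition.  The sums
   range over finite sets whenever S has only finitely many nonzero coefficients at n. *)

definition shiftop_act :: "'n::finite shiftop \<Rightarrow> (nat \<Rightarrow> 'n mpoly) \<Rightarrow> nat \<Rightarrow> 'n mpoly" where
  "shiftop_act S P n =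
     (\<Sum>i | S i n \<noteq> 0 \<and> 0 \<le> int n + i. mconst (S i n) ** P (nat (int n + i)))"

definition shiftop_comp :: "'n::finite shiftop \<Rightarrow> 'n shiftop \<Rightarrow> 'n shiftop" where
  "shiftop_comp S R = (\<lambda>j n.
     \<Sum>i | S i n \<noteq> 0 \<and> 0 \<le> int n + i. S i n ** R (j - i) (nat (int n + i)))"

definition shiftop_id :: "'n::finite shiftop" where
  "shiftop_id = (\<lambda>j n. if j = 0 then mat 1 else 0)"

definition shiftop_poly :: "complex poly \<Rightarrow> 'n::finite shiftop \<Rightarrow> 'n shiftop" where
  "shiftop_poly p S = (\<lambda>j n.
     \<Sum>i\<le>degree p. mat (coeff p i) ** ((shiftop_comp S ^^ i) shiftop_id) j n)"

definition X_coeff :: "(nat \<Rightarrow> 'n::finite mpoly) \<Rightarrow> nat \<Rightarrow> 'n cmat" where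
  "X_coeff P n = mcoeff (P n) (int n - 1)"

definition Y_coeff :: "(nat \<Rightarrow> 'n::finite mpoly) \<Rightarrow> nat \<Rightarrow> 'n cmat" where
  "Y_coeff P n = mcoeff (P n) (int n - 2)"

definition B_coeff :: "(nat \<Rightarrow> 'n::finite mpoly) \<Rightarrow> nat \<Rightarrow> 'n cmat" where
  "B_coeff P n = X_coeff P n - X_coeff P (n + 1)"

(* H(n) H(n-1)^(-1) with H(n) = <P(.,n), P(.,n)>.  C(0) multiplies P(.,-1) = 0. *)
definition C_coeff :: "(real \<Rightarrow> 'n::finite cmat) \<Rightarrow> (nat \<Rightarrow> 'n mpoly) \<Rightarrow> nat \<Rightarrow> 'n cmat" where
  "C_coeff W P n =
     (if n = 0 then 0
      else mip W (P n) (P n) ** matrix_inv (mip W (P (n - 1)) (P (n - 1))))"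

definition L_op :: "(real \<Rightarrow> 'n::finite cmat) \<Rightarrow> (nat \<Rightarrow> 'n mpoly) \<Rightarrow> 'n shiftop" where
  "L_op W P = (\<lambda>j n.
     if j = 1 then mat 1 else if j = 0 then B_coeff P n
     else if j = -1 then C_coeff W P n else 0)"

end

theory Submission imports Defs begin

text \<open>
  Let \<open>D\<^sup>\<dagger> = - D + C + v'\<close> be the adjoint and \<open>H(m)\<close> the squared norm of \<open>P(m)\<close>.  The polynomial
  \<open>P(n) \<cdot> D\<close> has degree at most \<open>n + 1\<close>, so it is a left combination of \<open>P(0), \<dots>, P(n + 1)\<close>, and
  its coefficient at \<open>P(m)\<close> is \<open>\<langle>P(n) \<cdot> D, P(m)\<rangle> H(m)\<^sup>-\<^sup>1\<close> (lemma \<open>P_expansion\<close>).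

  The coefficients at \<open>P(n + 1)\<close>, \<open>P(n)\<close> and \<open>P(n - 1)\<close> follow by comparing powers of \<open>x\<close>; this is
  where \<open>A\<^sub>1\<close>, \<open>A\<^sub>0\<close> and \<open>A\<^sub>-\<^sub>1\<close> come from.  For \<open>m < n - 1\<close> the adjoint gives
  \<open>\<langle>P(n), P(m) \<cdot> D\<^sup>\<dagger>\<rangle>\<close>.  Here \<open>- D + C\<close> raises the degree by at most one, hence contributes
  nothing against \<open>P(n)\<close>, and what remains is \<open>\<langle>P(n), P(m) v'\<rangle>\<close>.  This vanishes if
  \<open>m - n < 1 - k\<close>, again for reasons of degree.  Otherwise \<open>v'\<close> is moved to the left factor, and
  \<open>\<langle>P(n) v', P(m)\<rangle> = v'(L)\<^sub>m\<^sub>-\<^sub>n(n) H(m)\<close>, because multiplication by \<open>x\<close> acts on the sequence as \<open>L\<close>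
  (lemmas \<open>three_term_recurrence\<close> and \<open>mip_shiftop_poly\<close>).

  Moving \<open>v'\<close> across the inner product conjugates its coefficients, so one needs that they are
  real (lemma \<open>scalar_part_real\<close>).  The operator \<open>D + D\<^sup>\<dagger>\<close> is symmetric, and it is the
  multiplication by \<open>A x - J + v'\<close>.  The first row of \<open>A\<close> is zero and the first row of \<open>J\<close> is that
  of the identity.  Hence, with \<open>E\<close> the first diagonal matrix unit, this multiplication sends \<open>E p\<close>
  to \<open>E p (v' - 1)\<close> for every scalar polynomial \<open>p\<close>, and symmetry on such multiples of \<open>E\<close> forces
  \<open>v' - 1\<close> to equal its conjugate.

  Hermitian symmetry and definiteness of the inner product are read off from the expansion in the
  \<open>P(m)\<close>, where the inner product becomes \<open>\<Sum>\<^sub>m K\<^sub>m H(m) L\<^sub>m\<^sup>*\<close>.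
\<close>

section \<open>Matrix arithmetic\<close>

lemma matrix_add_rdistrib: "(A + B) ** C = A ** C + B ** C"
  for A B :: "'a::semiring_1^'n^'m"
  by (vector matrix_matrix_mult_def sum.distrib distrib_right)

lemma matrix_minus_left: "(- A) ** B = - (A ** B)" for A :: "'a::ring_1^'n^'m"
  by (vector matrix_matrix_mult_def sum_negf)

lemma matrix_minus_right: "A ** (- B) = - (A ** B)" for A :: "'a::ring_1^'n^'m"
  by (vector matrix_matrix_mult_def sum_negf)

lemma matrix_diff_ldistrib: "A ** (B - C) = A ** B - A ** C" for A :: "'a::ring_1^'n^'m"
  by (vector matrix_matrix_mult_def sum_subtractf right_diff_distrib)

lemma matrix_diff_rdistrib: "(A - B) ** C = A ** C - B ** C" for A :: "'a::ring_1^'n^'m"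
  by (vector matrix_matrix_mult_def sum_subtractf left_diff_distrib)

lemma matrix_zero_left [simp]: "0 ** A = 0" for A :: "'a::semiring_1^'n^'m"
  by (vector matrix_matrix_mult_def)

lemma matrix_zero_right [simp]: "A ** 0 = 0" for A :: "'a::semiring_1^'n^'m"
  by (vector matrix_matrix_mult_def)

lemma matrix_sum_right: "A ** (\<Sum>i\<in>I. f i) = (\<Sum>i\<in>I. A ** f i)"
  for A :: "'a::semiring_1^'n^'m"
  by (induction I rule: infinite_finite_induct) (auto simp: matrix_add_ldistrib)

lemma matrix_sum_left: "(\<Sum>i\<in>I. f i) ** A = (\<Sum>i\<in>I. f i ** A)"
  for A :: "'a::semiring_1^'n^'m"
  by (induction I rule: infinite_finite_induct) (auto simp: matrix_add_rdistrib)

lemmas matrix_algebra = matrix_add_ldistrib matrix_add_rdistrib matrix_minus_left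
  matrix_minus_right matrix_diff_ldistrib matrix_diff_rdistrib

lemma mat_mult_nth: "(mat c ** A) $ i $ j = c * A $ i $ j" for A :: "'a::semiring_1^'n^'m"
  by (simp add: matrix_matrix_mult_def mat_def if_distrib[of "\<lambda>x. x * _"] sum.delta' cong: if_cong)

lemma mult_mat_nth: "(A ** mat c) $ i $ j = A $ i $ j * c" for A :: "'a::semiring_1^'n^'m"
  by (simp add: matrix_matrix_mult_def mat_def if_distrib[of "\<lambda>x. _ * x"] sum.delta cong: if_cong)

lemma mat_mult_commute: "mat c ** A = A ** mat c" for A :: "'a::comm_semiring_1^'n^'n"
  by (simp add: vec_eq_iff mat_mult_nth mult_mat_nth mult.commute)

lemma mat_mult_left_commute: "A ** (mat c ** B) = mat c ** (A ** B)"
  for A :: "'a::comm_semiring_1^'n^'n"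
  by (metis mat_mult_commute matrix_mul_assoc)

lemma mat_add: "mat (a + b) = mat a + mat b" for a :: "'a::semiring_1"
  by (simp add: vec_eq_iff mat_def)

lemma mat_diff: "mat (a - b) = mat a - mat b" for a :: "'a::ring_1"
  by (simp add: vec_eq_iff mat_def)

lemma mat_mult: "mat (a * b) = mat a ** mat b" for a :: "'a::semiring_1"
  by (simp add: vec_eq_iff mat_mult_nth) (simp add: mat_def)

lemma mat_sum: "mat (\<Sum>i\<in>I. f i) = (\<Sum>i\<in>I. mat (f i))" for f :: "'b \<Rightarrow> 'a::semiring_1"
  by (induction I rule: infinite_finite_induct) (auto simp: mat_add)

lemma mstar_nth [simp]: "mstar M $ i $ j = cnj (M $ j $ i)"
  by (simp add: mstar_def)

lemma mstar_mult: "mstar (A ** B) = mstar B ** mstar A"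
  by (simp add: vec_eq_iff matrix_matrix_mult_def mult.commute)

lemma mstar_mstar [simp]: "mstar (mstar M) = M"
  by (simp add: vec_eq_iff)

lemma mstar_zero [simp]: "mstar 0 = 0"
  by (simp add: vec_eq_iff)

lemma mstar_add: "mstar (A + B) = mstar A + mstar B"
  by (simp add: vec_eq_iff)

lemma mstar_mat: "mstar (mat c) = mat (cnj c)"
  by (simp add: vec_eq_iff mat_def)

lemma mstar_scaleR: "mstar (c *\<^sub>R M) = c *\<^sub>R mstar M"
  by (simp add: vec_eq_iff)

lemma mstar_sum: "mstar (\<Sum>i\<in>I. f i) = (\<Sum>i\<in>I. mstar (f i))"
  by (induction I rule: infinite_finite_induct) (auto simp: mstar_add)

lemma posdef_invertible:
  assumes "posdef H" shows "invertible H"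
proof -
  have "u = 0" if "H *v u = 0" for u
  proof (rule ccontr)
    assume "u \<noteq> 0"
    have "(\<Sum>i\<in>UNIV. \<Sum>j\<in>UNIV. cnj (u $ i) * H $ i $ j * u $ j)
        = (\<Sum>i\<in>UNIV. cnj (u $ i) * (H *v u) $ i)"
      by (simp add: matrix_vector_mult_def sum_distrib_left mult.assoc)
    with that assms \<open>u \<noteq> 0\<close> show False
      unfolding posdef_def by (metis (no_types, lifting) mult_zero_right sum.neutral zero_complex.sel(1) zero_index less_irrefl)
  qed
  then show ?thesis
    using invertible_left_inverse matrix_left_invertible_ker by blast
qed

lemma invertible_mult_inv:
  fixes H :: "complex^'n^'n"
  assumes "invertible H"
  shows "H ** matrix_inv H = mat 1" "matrix_inv H ** H = mat 1"
  using assms someI_ex[of "\<lambda>A'. H ** A' = mat 1 \<and> A' ** H = mat 1"]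
  unfolding invertible_def matrix_inv_def by auto

lemma congruence_diag_nth:
  assumes "\<And>l. u $ l = cnj (K $ i $ l)"
  shows "(K ** H ** mstar K) $ i $ i =
    (\<Sum>p\<in>UNIV. \<Sum>q\<in>UNIV. cnj (u $ p) * H $ p $ q * u $ q)"
  by (simp add: matrix_matrix_mult_def sum_distrib_right assms, rule sum.swap)

text \<open>The diagonal entries of \<open>K H K\<^sup>*\<close> are the values of the positive definite form \<open>H\<close> at the
  conjugated rows of \<open>K\<close>, so nonzero rows contribute strictly and cannot cancel in a sum of such matrices.\<close>
lemma posdef_congruence_diag:
  assumes "posdef H"
  shows "K $ i = 0 \<or> 0 < Re ((K ** H ** mstar K) $ i $ i)"
proof -
  define u where "u = (\<chi> l. cnj (K $ i $ l))"
  have u: "u $ l = cnj (K $ i $ l)" for l by (simp add: u_def)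
  show ?thesis
  proof (cases "u = 0")
    case True
    have "K $ i $ l = 0" for l
      using u[of l] unfolding True by simp
    then show ?thesis by (simp add: vec_eq_iff)
  next
    case False
    then have "0 < Re (\<Sum>p\<in>UNIV. \<Sum>q\<in>UNIV. cnj (u $ p) * H $ p $ q * u $ q)"
      using assms unfolding posdef_def by blast
    then show ?thesis unfolding congruence_diag_nth[of u K i H, OF u] ..
  qed
qed

section \<open>Matrix polynomials\<close>

text \<open>The strict bound makes \<open>d = 0\<close> describe the zero polynomial, so that induction on \<open>d\<close> starts
  without a special case.\<close>
definition degree_below :: "nat \<Rightarrow> 'n::finite mpoly \<Rightarrow> bool" where
  "degree_below d P \<longleftrightarrow> (\<forall>m \<ge> int d. mcoeff P m = 0)"

lemma degree_below_iff: "degree_below d P \<longleftrightarrow> (\<forall>m\<ge>d. \<forall>i j. coeff (P $ i $ j) m = 0)"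
proof
  assume L: "degree_below d P"
  show "\<forall>m\<ge>d. \<forall>i j. coeff (P $ i $ j) m = 0"
  proof (intro allI impI)
    fix m i j assume "d \<le> m"
    with L have "mcoeff P (int m) = 0" unfolding degree_below_def by simp
    then show "coeff (P $ i $ j) m = 0" by (simp add: mcoeff_def vec_eq_iff)
  qed
next
  assume "\<forall>m\<ge>d. \<forall>i j. coeff (P $ i $ j) m = 0"
  then show "degree_below d P"
    unfolding degree_below_def mcoeff_def by (auto simp: vec_eq_iff)
qed

lemma mpoly_eqI:
  assumes "\<And>m. mcoeff P (int m) = mcoeff Q (int m)" shows "P = Q"
  using assms by (simp add: mcoeff_def vec_eq_iff poly_eq_iff)

lemma degree_below_0 [simp]: "degree_below 0 P \<longleftrightarrow> P = 0"
  by (auto simp: degree_below_iff vec_eq_iff poly_eq_iff)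

lemma degree_below_mono: "degree_below d P \<Longrightarrow> d \<le> e \<Longrightarrow> degree_below e P"
  by (auto simp: degree_below_iff)

lemma ex_degree_below: "\<exists>d. degree_below d P"
proof (intro exI)
  show "degree_below (Suc (\<Sum>i\<in>UNIV. \<Sum>j\<in>UNIV. degree (P $ i $ j))) P"
    unfolding degree_below_iff
  proof (intro allI impI)
    fix m i j assume m: "Suc (\<Sum>i\<in>UNIV. \<Sum>j\<in>UNIV. degree (P $ i $ j)) \<le> m"
    have "degree (P $ i $ j) \<le> (\<Sum>j\<in>UNIV. degree (P $ i $ j))"
      by (rule member_le_sum) auto
    also have "\<dots> \<le> (\<Sum>i\<in>UNIV. \<Sum>j\<in>UNIV. degree (P $ i $ j))"
      by (rule member_le_sum) auto
    finally show "coeff (P $ i $ j) m = 0"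
      using m by (intro coeff_eq_0) linarith
  qed
qed

lemma mcoeff_neg: "m < 0 \<Longrightarrow> mcoeff P m = 0"
  by (simp add: mcoeff_def)

lemma mcoeff_0 [simp]: "mcoeff 0 m = 0"
  by (simp add: mcoeff_def vec_eq_iff)

lemma mcoeff_add: "mcoeff (P + Q) m = mcoeff P m + mcoeff Q m"
  by (simp add: mcoeff_def vec_eq_iff)

lemma mcoeff_diff: "mcoeff (P - Q) m = mcoeff P m - mcoeff Q m"
  by (simp add: mcoeff_def vec_eq_iff)

lemma mcoeff_mconst_left: "mcoeff (mconst K ** P) m = K ** mcoeff P m"
  by (simp add: mcoeff_def mconst_def matrix_matrix_mult_def vec_eq_iff coeff_sum)

lemma mcoeff_mconst_right: "mcoeff (P ** mconst K) m = mcoeff P m ** K"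
  by (simp add: mcoeff_def mconst_def matrix_matrix_mult_def vec_eq_iff coeff_sum mult.commute)

lemma mcoeff_xpoly: "mcoeff (P ** xpoly) m = mcoeff P (m - 1)"
proof (cases "m < 1")
  case True
  then show ?thesis
    by (cases "m = 0") (auto simp: mcoeff_def xpoly_def vec_eq_iff mult_mat_nth coeff_pCons)
next
  case False
  then obtain l where "m = int (Suc l)"
    by (intro that[of "nat (m - 1)"]) simp
  then show ?thesis
    by (auto simp: mcoeff_def xpoly_def vec_eq_iff mult_mat_nth coeff_pCons nat_add_distrib)
qed

text \<open>The Euler operator \<open>x d/dx\<close> is diagonal on the powers of \<open>x\<close>; the identity also holds for negative \<open>m\<close>,
  where both sides are zero.\<close>
lemma mcoeff_mderiv_xpoly: "mcoeff (mderiv P ** xpoly) m = mat (of_int m) ** mcoeff P m"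
proof (cases "m < 1")
  case True
  then show ?thesis
    unfolding mcoeff_xpoly by (cases "m = 0") (auto simp: mcoeff_neg)
next
  case False
  then obtain l where "m = int (Suc l)"
    by (intro that[of "nat (m - 1)"]) simp
  then show ?thesis
    unfolding mcoeff_xpoly
    by (simp add: mcoeff_def mderiv_def vec_eq_iff mat_mult_nth coeff_pderiv nat_add_distrib)
qed

lemma degree_below_Suc:
  assumes "degree_below (Suc d) P" "mcoeff P (int d) = 0" shows "degree_below d P"
  unfolding degree_below_def
proof (intro allI impI)
  fix m assume "int d \<le> m"
  then have "m = int d \<or> int (Suc d) \<le> m" by auto
  then show "mcoeff P m = 0" using assms unfolding degree_below_def by auto
qed

lemma degree_below_add: "degree_below d P \<Longrightarrow> degree_below d Q \<Longrightarrow> degree_below d (P + Q)"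
  by (simp add: degree_below_def mcoeff_add)

lemma degree_below_diff: "degree_below d P \<Longrightarrow> degree_below d Q \<Longrightarrow> degree_below d (P - Q)"
  by (simp add: degree_below_def mcoeff_diff)

lemma degree_below_mconst_left: "degree_below d P \<Longrightarrow> degree_below d (mconst K ** P)"
  by (simp add: degree_below_def mcoeff_mconst_left)

lemma degree_below_mconst_right: "degree_below d P \<Longrightarrow> degree_below d (P ** mconst K)"
  by (simp add: degree_below_def mcoeff_mconst_right)

lemma degree_below_xpoly: "degree_below d P \<Longrightarrow> degree_below (Suc d) (P ** xpoly)"
  by (simp add: degree_below_def mcoeff_xpoly)

lemma degree_below_mderiv_xpoly: "degree_below d P \<Longrightarrow> degree_below d (mderiv P ** xpoly)"
  by (simp add: degree_below_def mcoeff_mderiv_xpoly)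

lemma degree_below_mat:
  assumes "degree_below d P" "degree q \<le> e"
  shows "degree_below (d + e) (P ** mat q)"
proof -
  have "coeff (P $ i $ j * q) m = 0" if "d + e \<le> m" for i j m
  proof -
    have "coeff (P $ i $ j) l * coeff q (m - l) = 0" if "l \<le> m" for l
    proof (cases "d \<le> l")
      case True then show ?thesis using assms by (simp add: degree_below_iff)
    next
      case False
      then have "degree q < m - l" using assms \<open>d + e \<le> m\<close> by linarith
      then show ?thesis by (simp add: coeff_eq_0)
    qed
    then show ?thesis unfolding coeff_mult by (intro sum.neutral) blast
  qed
  then show ?thesis by (simp add: degree_below_iff mult_mat_nth)
qed

lemma monic_of_degree_below: "monic_of_degree n P \<Longrightarrow> degree_below (Suc n) P"
  by (auto simp: monic_of_degree_def degree_below_def)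

lemma mconst_mult: "mconst (K ** L) = mconst K ** mconst L"
  by (intro mpoly_eqI) (simp add: mcoeff_mconst_left, simp add: mcoeff_def mconst_def matrix_matrix_mult_def vec_eq_iff coeff_pCons split: nat.split)

lemma mconst_0 [simp]: "mconst 0 = 0"
  by (simp add: mconst_def vec_eq_iff)

lemma mconst_mat: "mconst (mat c) = mat [:c:]"
  by (simp add: mconst_def mat_def vec_eq_iff)

lemma meval_mult: "meval (P ** Q) x = meval P x ** meval Q x"
  by (simp add: meval_def matrix_matrix_mult_def vec_eq_iff poly_sum)

lemma meval_add: "meval (P + Q) x = meval P x + meval Q x"
  by (simp add: meval_def vec_eq_iff)

lemma meval_mconst [simp]: "meval (mconst K) x = K"
  by (simp add: meval_def mconst_def vec_eq_iff)

lemma meval_mat: "meval (mat q) x = mat (poly q x)"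
  by (simp add: meval_def mat_def vec_eq_iff)

lemma meval_expand:
  assumes "degree_below d P"
  shows "meval P (of_real x) = (\<Sum>m<d. x ^ m *\<^sub>R mcoeff P (int m))"
proof -
  have "poly p (of_real x) = (\<Sum>m<d. of_real x ^ m * coeff p m)" if "\<forall>m\<ge>d. coeff p m = 0"
    for p :: "complex poly"
  proof -
    have "{..degree p} = {..<Suc (degree p)}" by auto
    have "poly p (of_real x) = (\<Sum>m\<le>degree p. coeff p m * of_real x ^ m)"
      by (rule poly_altdef)
    also have "\<dots> = (\<Sum>m<max d (Suc (degree p)). coeff p m * of_real x ^ m)"
      by (rule sum.mono_neutral_left) (auto simp: coeff_eq_0)
    also have "\<dots> = (\<Sum>m<d. coeff p m * of_real x ^ m)"
      by (rule sum.mono_neutral_right) (auto simp: that)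
    finally show ?thesis by (simp add: mult.commute)
  qed
  then show ?thesis
    using assms by (simp add: degree_below_iff meval_def mcoeff_def vec_eq_iff) (simp add: scaleR_conv_of_real)
qed

section \<open>First order differential operators\<close>

lemma diffop_act_order_1:
  "diffop_act Q (monom F 1 + monom G 0) = mderiv Q ** F + Q ** G"
proof -
  define D where "D = monom F 1 + monom G 0"
  have "degree D \<le> 1"
    unfolding D_def by (intro degree_add_le degree_monom_le order.trans[OF degree_monom_le]) auto
  then have "diffop_act Q D = (\<Sum>j\<le>1. (mderiv ^^ j) Q ** coeff D j)"
    unfolding diffop_act_def by (intro sum.mono_neutral_left) (auto simp: coeff_eq_0 not_le)
  also have "\<dots> = mderiv Q ** F + Q ** G"
    by (simp add: D_def atMost_Suc)
  finally show ?thesis unfolding D_def .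
qed

section \<open>The matrix inner product\<close>

lemma bounded_linear_sandwich: "bounded_linear (\<lambda>Z::'n::finite cmat. K ** Z ** L)"
proof -
  have "linear (\<lambda>Z::'n cmat. K ** Z ** L)"
    by (intro linearI) (auto simp: matrix_algebra matrix_scalar_ac scalar_matrix_assoc[symmetric])
  then show ?thesis by (simp add: linear_conv_bounded_linear)
qed

text \<open>Expanding both polynomials in powers of \<open>x\<close> turns the integrand into a finite sum of
  moment integrands with constant matrices on both sides.\<close>
lemma mip_integrable:
  assumes "finite_moments W"
  shows "set_integrable lborel {0..}
    (\<lambda>x. meval P (of_real x) ** W x ** mstar (meval Q (of_real x)))"
proof -
  obtain d e where d: "degree_below d P" and e: "degree_below e Q"
    using ex_degree_below by blast
  have "meval P (of_real x) ** W x ** mstar (meval Q (of_real x)) =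
      (\<Sum>m<d. \<Sum>l<e. mcoeff P (int m) ** (x ^ (m + l) *\<^sub>R W x) ** mstar (mcoeff Q (int l)))" for x
    unfolding meval_expand[OF d] meval_expand[OF e]
    by (simp add: matrix_sum_left matrix_sum_right mstar_sum mstar_scaleR matrix_scalar_ac
        scalar_matrix_assoc[symmetric] power_add scaleR_sum_right)
      (rule trans[OF sum.swap], intro sum.cong refl, simp add: mult.commute)
  moreover have moment: "integrable lborel (\<lambda>x. indicator {0..} x *\<^sub>R (x ^ m *\<^sub>R W x))" for m
    using assms unfolding finite_moments_def set_integrable_def by blast
  moreover have "integrable lborel (\<lambda>x. \<Sum>m<d. \<Sum>l<e.
      mcoeff P (int m) ** (indicator {0..} x *\<^sub>R (x ^ (m + l) *\<^sub>R W x)) ** mstar (mcoeff Q (int l)))"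
    by (intro Bochner_Integration.integrable_sum integrable_bounded_linear[OF bounded_linear_sandwich moment])
  moreover have "(\<Sum>m<d. \<Sum>l<e.
      mcoeff P (int m) ** (indicator {0..} x *\<^sub>R (x ^ (m + l) *\<^sub>R W x)) ** mstar (mcoeff Q (int l)))
    = indicator {0..} x *\<^sub>R (\<Sum>m<d. \<Sum>l<e.
      mcoeff P (int m) ** (x ^ (m + l) *\<^sub>R W x) ** mstar (mcoeff Q (int l)))" for x :: real
    by (simp add: matrix_scalar_ac scalar_matrix_assoc[symmetric] scaleR_sum_right)
  ultimately show ?thesis unfolding set_integrable_def by simp
qed

lemma mip_add_left:
  assumes "finite_moments W" shows "mip W (P + P') Q = mip W P Q + mip W P' Q"
  unfolding mip_def using mip_integrable[OF assms]
  by (simp add: meval_add matrix_algebra set_integral_add)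

lemma mip_add_right:
  assumes "finite_moments W" shows "mip W P (Q + Q') = mip W P Q + mip W P Q'"
  unfolding mip_def using mip_integrable[OF assms]
  by (simp add: meval_add matrix_algebra mstar_add set_integral_add)

lemma mip_mconst_left:
  assumes "finite_moments W" shows "mip W (mconst K ** P) Q = K ** mip W P Q"
  using integral_bounded_linear[OF bounded_linear_sandwich[of K "mat 1"]
      mip_integrable[OF assms, unfolded set_integrable_def]]
  unfolding mip_def set_lebesgue_integral_def
  by (simp add: meval_mult matrix_scalar_ac scalar_matrix_assoc[symmetric] matrix_mul_assoc)

lemma mip_mconst_right:
  assumes "finite_moments W" shows "mip W P (mconst K ** Q) = mip W P Q ** mstar K"
  using integral_bounded_linear[OF bounded_linear_sandwich[of "mat 1" "mstar K"]
      mip_integrable[OF assms, unfolded set_integrable_def]]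
  unfolding mip_def set_lebesgue_integral_def
  by (simp add: meval_mult mstar_mult matrix_scalar_ac scalar_matrix_assoc[symmetric] matrix_mul_assoc)

text \<open>A scalar polynomial commutes with \<open>W\<close>, and on the real line conjugating its values is the same as
  conjugating its coefficients.\<close>
lemma mip_mat_right:
  "mip W P (Q ** mat q) = mip W (P ** mat (map_poly cnj q)) Q"
  unfolding mip_def 
  by (simp add: meval_mult mstar_mult meval_mat mstar_mat matrix_mul_assoc
      flip: mat_mult_commute)

section \<open>Expansion in orthogonal polynomials\<close>

locale monic_orthogonal_sequence =
  fixes W :: "real \<Rightarrow> 'n::finite cmat" and P :: "nat \<Rightarrow> 'n mpoly"
  assumes moments: "finite_moments W" and orth: "monic_orthogonal W P"
begin

definition H :: "nat \<Rightarrow> 'n cmat" where "H n = mip W (P n) (P n)"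

lemmas mip_add_left = mip_add_left[OF moments]
  and mip_add_right = mip_add_right[OF moments]
  and mip_mconst_left = mip_mconst_left[OF moments]
  and mip_mconst_right = mip_mconst_right[OF moments]

lemma mip_zero_left [simp]: "mip W 0 Q = 0"
  using mip_mconst_left[of 0 0 Q] by simp

lemma mip_zero_right [simp]: "mip W Q 0 = 0"
  using mip_mconst_right[of Q 0 0] by simp

lemma mip_diff_left: "mip W (Q - R) S = mip W Q S - mip W R S"
  using mip_add_left[of "Q - R" R S] by simp

lemma mip_diff_right: "mip W S (Q - R) = mip W S Q - mip W S R"
  using mip_add_right[of S "Q - R" R] by simp

lemma mip_sum_left: "mip W (\<Sum>i\<in>I. f i) Q = (\<Sum>i\<in>I. mip W (f i) Q)"
  by (induction I rule: infinite_finite_induct) (auto simp: mip_add_left)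

lemma mip_sum_right: "mip W Q (\<Sum>i\<in>I. f i) = (\<Sum>i\<in>I. mip W Q (f i))"
  by (induction I rule: infinite_finite_induct) (auto simp: mip_add_right)

lemma mip_P: "mip W (P m) (P n) = (if m = n then H n else 0)"
  using orth unfolding monic_orthogonal_def H_def by auto

lemma H_posdef: "posdef (H n)"
  using orth unfolding monic_orthogonal_def H_def by auto

lemma H_inv: "H n ** matrix_inv (H n) = mat 1" "matrix_inv (H n) ** H n = mat 1"
  using invertible_mult_inv posdef_invertible[OF H_posdef] by auto

lemma H_cancel: "K ** H n ** matrix_inv (H n) = K" "K ** matrix_inv (H n) ** H n = K"
  by (simp_all flip: matrix_mul_assoc add: H_inv)

lemma P_monic: "mcoeff (P n) (int n) = mat 1"
  using orth unfolding monic_orthogonal_def monic_of_degree_def by auto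

lemma P_degree: "degree_below (Suc n) (P n)"
  using orth unfolding monic_orthogonal_def by (simp add: monic_of_degree_below)

text \<open>Each \<open>P(d)\<close> is monic, so the leading term of a polynomial can be removed by subtracting a left
  multiple of it.\<close>
lemma ex_P_expansion:
  "degree_below d Q \<Longrightarrow> \<exists>K. Q = (\<Sum>m<d. mconst (K m) ** P m)"
proof (induction d arbitrary: Q)
  case (Suc d)
  define R where "R = Q - mconst (mcoeff Q (int d)) ** P d"
  have "degree_below (Suc d) R"
    unfolding R_def by (intro degree_below_diff degree_below_mconst_left Suc.prems P_degree)
  moreover have "mcoeff R (int d) = 0"
    by (simp add: R_def mcoeff_diff mcoeff_mconst_left P_monic)
  ultimately obtain K where K: "R = (\<Sum>m<d. mconst (K m) ** P m)"
    using Suc.IH degree_below_Suc by blast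
  have "Q = (\<Sum>m<Suc d. mconst ((K(d := mcoeff Q (int d))) m) ** P m)"
    using K unfolding R_def by (simp add: algebra_simps)
  then show ?case by blast
qed simp

lemma mip_expansion_P:
  "mip W (\<Sum>m<d. mconst (K m) ** P m) (P l) = (if l < d then K l ** H l else 0)"
  by (simp add: mip_sum_left mip_mconst_left mip_P if_distrib[of "(**) _"] cong: if_cong)

lemma P_expansion:
  assumes "degree_below d Q"
  shows "Q = (\<Sum>m<d. mconst (mip W Q (P m) ** matrix_inv (H m)) ** P m)"
proof -
  obtain K where K: "Q = (\<Sum>m<d. mconst (K m) ** P m)"
    using ex_P_expansion[OF assms] ..
  have "mip W Q (P m) ** matrix_inv (H m) = K m" if "m < d" for m
    using that unfolding K mip_expansion_P by (simp add: H_cancel)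
  then have "(\<Sum>m<d. mconst (mip W Q (P m) ** matrix_inv (H m)) ** P m)
      = (\<Sum>m<d. mconst (K m) ** P m)" by simp
  then show ?thesis using K by simp
qed

lemma expansion_eqI:
  assumes deg: "degree_below d Q"
    and coeffs: "\<And>m. m < d \<Longrightarrow> mip W Q (P m) = K m ** H m"
  shows "Q = (\<Sum>m<d. mconst (K m) ** P m)"
  by (subst P_expansion[OF deg], intro sum.cong refl) (simp add: coeffs H_cancel)

text \<open>In the coordinates given by the \<open>P(m)\<close> the inner product is a finite sum, which yields its
  Hermitian symmetry and its definiteness.\<close>
lemma mip_expansion:
  "mip W (\<Sum>m<d. mconst (K m) ** P m) (\<Sum>l<d. mconst (L l) ** P l)
    = (\<Sum>m<d. K m ** H m ** mstar (L m))"
  by (simp add: mip_sum_right mip_mconst_right mip_expansion_P)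

lemma mip_P_low:
  assumes "degree_below n Q" shows "mip W (P n) Q = 0"
proof -
  obtain K where K: "Q = (\<Sum>m<n. mconst (K m) ** P m)"
    using ex_P_expansion[OF assms] ..
  show ?thesis unfolding K by (simp add: mip_sum_right mip_mconst_right mip_P)
qed

lemma ex_common_expansion:
  "\<exists>d K L. Q = (\<Sum>m<d. mconst (K m) ** P m) \<and> R = (\<Sum>m<d. mconst (L m) ** P m)"
proof -
  obtain d e where "degree_below d Q" "degree_below e R"
    using ex_degree_below by blast
  then have "degree_below (max d e) Q" "degree_below (max d e) R"
    by (auto intro: degree_below_mono)
  then show ?thesis using ex_P_expansion by blast
qed

lemma mstar_mip: "mstar (mip W Q R) = mip W R Q"
proof -
  obtain d K L where QR: "Q = (\<Sum>m<d. mconst (K m) ** P m)" "R = (\<Sum>m<d. mconst (L m) ** P m)"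
    using ex_common_expansion by blast
  have "mstar (H m) = H m" for m using H_posdef by (simp add: posdef_def)
  then show ?thesis
    unfolding QR mip_expansion by (simp add: mstar_sum mstar_mult matrix_mul_assoc)
qed

lemma mip_definite:
  assumes "mip W Q Q = 0" shows "Q = 0"
proof -
  obtain d K where Q: "Q = (\<Sum>m<d. mconst (K m) ** P m)"
    using ex_common_expansion by blast
  have pos: "K m $ i = 0 \<or> 0 < Re ((K m ** H m ** mstar (K m)) $ i $ i)" for m i
    using posdef_congruence_diag[OF H_posdef] by blast
  have "(K m $ i) = 0" if "m < d" for m i
  proof -
    have "(\<Sum>m<d. Re ((K m ** H m ** mstar (K m)) $ i $ i)) = Re (mip W Q Q $ i $ i)"
      unfolding Q mip_expansion by simp
    also have "\<dots> = 0" using assms by simp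
    finally have sum0: "(\<Sum>m<d. Re ((K m ** H m ** mstar (K m)) $ i $ i)) = 0" .
    have nonneg: "0 \<le> Re ((K m ** H m ** mstar (K m)) $ i $ i)" for m
    proof (cases "K m $ i = 0")
      case True
      then have "(K m ** H m ** mstar (K m)) $ i $ i = 0"
        by (simp add: matrix_matrix_mult_def)
      then show ?thesis by simp
    next
      case False then show ?thesis using pos[of m i] by simp
    qed
    have "Re ((K m ** H m ** mstar (K m)) $ i $ i) = 0"
      using sum0 that nonneg by (subst (asm) sum_nonneg_eq_0_iff) auto
    then show ?thesis using pos[of m i] by auto
  qed
  then have "K m = 0" if "m < d" for m using that by (simp add: vec_eq_iff)
  then show ?thesis unfolding Q by simp
qed

lemma mip_xpoly: "mip W (Q ** xpoly) R = mip W Q (R ** xpoly)"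
  unfolding xpoly_def mip_mat_right by (simp add: map_poly_pCons)

section \<open>The three-term recurrence\<close>

lemma C_coeff_H: "C_coeff W P (Suc n) ** H n = H (Suc n)"
  by (simp add: C_coeff_def H_cancel flip: H_def)

text \<open>Multiplication by \<open>x\<close> is symmetric, so \<open>\<langle>x P(n), P(m)\<rangle> = \<langle>P(n), x P(m)\<rangle>\<close> vanishes for \<open>m < n - 1\<close>
  and equals \<open>H(n)\<close> for \<open>m = n - 1\<close>, as \<open>x P(n - 1)\<close> and \<open>P(n)\<close> are both monic of degree \<open>n\<close>.\<close>
lemma three_term_recurrence:
  "P n ** xpoly = P (Suc n) + mconst (B_coeff P n) ** P n +
     (if n = 0 then 0 else mconst (C_coeff W P n) ** P (n - 1))"
proof -
  define T where "T = (if n = 0 then 0 else mconst (C_coeff W P n) ** P (n - 1))"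
  define R where "R = P n ** xpoly - P (Suc n) - mconst (B_coeff P n) ** P n"
  have "degree_below n T"
    using degree_below_mconst_left[OF P_degree[of "n - 1"]] by (cases n) (auto simp: T_def degree_below_def)
  have R2: "degree_below (Suc (Suc n)) R" unfolding R_def
    by (intro degree_below_diff degree_below_xpoly degree_below_mconst_left P_degree
        degree_below_mono[OF P_degree[of n]]) auto
  have "mcoeff (P n) (1 + int n) = 0"
    using P_degree[of n] by (simp add: degree_below_def)
  then have "mcoeff R (int (Suc n)) = 0"
    using P_monic[of "Suc n"]
    by (simp add: R_def mcoeff_diff mcoeff_mconst_left mcoeff_xpoly P_monic)
  with R2 have R1: "degree_below (Suc n) R" by (rule degree_below_Suc)
  have "mcoeff R (int n) = 0"
    by (simp add: R_def mcoeff_diff mcoeff_mconst_left mcoeff_xpoly P_monic B_coeff_def X_coeff_def)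
  with R1 have R0: "degree_below n R" by (rule degree_below_Suc)
  \<comment> \<open>Comparing the two leading coefficients leaves a remainder of degree below \<open>n\<close>; it is zero because it is
    orthogonal to all \<open>P(m)\<close> with \<open>m < n\<close>.\<close>
  have "mip W (R - T) (P m) = 0" if "m < n" for m
  proof -
    have "mip W (R - T) (P m) = mip W (P n) (P m ** xpoly) - mip W T (P m)"
      using that by (simp add: R_def mip_diff_left mip_mconst_left mip_P mip_xpoly)
    also have "\<dots> = 0"
    proof (cases "Suc m = n")
      case True
      have "degree_below n (P m ** xpoly - P n)"
      proof (rule degree_below_Suc)
        show "degree_below (Suc n) (P m ** xpoly - P n)"
          using True degree_below_xpoly[OF P_degree[of m]] P_degree[of n]
          by (auto intro: degree_below_diff)
        show "mcoeff (P m ** xpoly - P n) (int n) = 0"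
          using P_monic[of m] P_monic[of n] by (simp add: mcoeff_diff mcoeff_xpoly flip: True)
      qed
      then have "mip W (P n) (P m ** xpoly - P n) = 0" by (rule mip_P_low)
      then have "mip W (P n) (P m ** xpoly) = H n" by (simp add: mip_diff_right mip_P)
      moreover have "mip W T (P m) = H n"
        using C_coeff_H[of m] by (simp add: T_def mip_mconst_left mip_P flip: True)
      ultimately show ?thesis by simp
    next
      case False
      then have "degree_below n (P m ** xpoly)"
        using that by (intro degree_below_mono[OF degree_below_xpoly[OF P_degree[of m]]]) auto
      then have "mip W (P n) (P m ** xpoly) = 0" by (rule mip_P_low)
      moreover have "mip W T (P m) = 0"
        using False that by (auto simp: T_def mip_mconst_left mip_P)
      ultimately show ?thesis by simp
    qed
    finally show ?thesis .
  qed
  moreover have "degree_below n (R - T)"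
    using R0 \<open>degree_below n T\<close> by (rule degree_below_diff)
  ultimately have "R - T = 0"
    by (subst P_expansion) auto
  then show ?thesis unfolding R_def T_def by (simp add: algebra_simps)
qed

lemma shiftop_comp_L:
  "shiftop_comp (L_op W P) R j n = R (j - 1) (Suc n) + B_coeff P n ** R j n +
     (if n = 0 then 0 else C_coeff W P n ** R (j + 1) (n - 1))"
proof -
  have identity: "mat 1 \<noteq> (0 :: 'n cmat)"
    by (auto simp: vec_eq_iff mat_def)
  define I where "I = (if n = 0 then {0, 1} else {-1, 0, 1 :: int})"
  have "shiftop_comp (L_op W P) R j n
      = (\<Sum>i\<in>I. L_op W P i n ** R (j - i) (nat (int n + i)))"
    unfolding shiftop_comp_def
    using identity by (intro sum.mono_neutral_left) (auto simp: I_def L_op_def split: if_splits)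
  also have "\<dots> = R (j - 1) (Suc n) + B_coeff P n ** R j n +
     (if n = 0 then 0 else C_coeff W P n ** R (j + 1) (n - 1))"
    by (simp add: I_def L_op_def nat_add_distrib nat_diff_distrib algebra_simps)
  finally show ?thesis .
qed

text \<open>The recurrence says \<open>P x = L P\<close>, so \<open>P x\<^sup>i = L\<^sup>i P\<close>.  Stating this through inner products with
  \<open>P(m)\<close> isolates the single coefficient \<open>(L\<^sup>i)\<^sub>m\<^sub>-\<^sub>n(n)\<close>, and the induction step is exactly the rule for
  composing with \<open>L\<close> from the left.\<close>
lemma mip_power_L:
  "mip W (P n ** mat (monom 1 i)) (P m) =
     (shiftop_comp (L_op W P) ^^ i) shiftop_id (int m - int n) n ** H m"
proof (induction i arbitrary: n)
  case 0
  have "monom 1 0 = (1 :: complex poly)" by simp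
  then show ?case by (simp add: shiftop_id_def mip_P del: monom_0)
next
  case (Suc i)
  let ?R = "(shiftop_comp (L_op W P) ^^ i) shiftop_id"
  have "monom 1 (Suc i) = [:0, 1:] * (monom 1 i :: complex poly)"
    by (simp add: monom_Suc)
  then have "P n ** mat (monom 1 (Suc i)) = P n ** xpoly ** mat (monom 1 i)"
    by (simp only: mat_mult xpoly_def matrix_mul_assoc)
  also have "\<dots> = P (Suc n) ** mat (monom 1 i) + mconst (B_coeff P n) ** (P n ** mat (monom 1 i)) +
     (if n = 0 then 0 else mconst (C_coeff W P n) ** (P (n - 1) ** mat (monom 1 i)))"
    unfolding three_term_recurrence by (simp add: matrix_algebra matrix_mul_assoc)
  finally have "mip W (P n ** mat (monom 1 (Suc i))) (P m) =
      ?R (int m - int (Suc n)) (Suc n) ** H m + B_coeff P n ** (?R (int m - int n) n ** H m) +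
      (if n = 0 then 0 else C_coeff W P n ** (?R (int m - int (n - 1)) (n - 1) ** H m))"
    by (simp add: mip_add_left mip_mconst_left Suc.IH)
  also have "\<dots> = shiftop_comp (L_op W P) ?R (int m - int n) n ** H m"
    unfolding shiftop_comp_L
    by (cases n) (simp_all add: matrix_algebra matrix_mul_assoc algebra_simps)
  finally show ?case by simp
qed

lemma mip_shiftop_poly:
  "mip W (P n ** mat q) (P m) = shiftop_poly q (L_op W P) (int m - int n) n ** H m"
proof -
  have q: "mat q = (\<Sum>i\<le>degree q. mconst (mat (coeff q i)) ** mat (monom 1 i))"
    by (subst poly_as_sum_of_monoms[symmetric])
       (simp add: mat_sum mconst_mat smult_monom flip: mat_mult)
  have "P n ** mat q = (\<Sum>i\<le>degree q. mconst (mat (coeff q i)) ** (P n ** mat (monom 1 i)))"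
    by (subst q) (simp only: matrix_sum_right mconst_mat mat_mult_left_commute)
  then show ?thesis
    by (simp add: mip_sum_left mip_mconst_left mip_power_L shiftop_poly_def matrix_sum_left
        flip: matrix_mul_assoc)
qed

section \<open>Reality of the scalar part of the adjoint\<close>

text \<open>The conditions on row \<open>i0\<close> make the matrix unit \<open>E\<close> at \<open>(i0, i0)\<close> satisfy \<open>E S = E (q - c)\<close>.
  With \<open>r\<close> the difference of \<open>q - c\<close> and its conjugate, symmetry of \<open>S\<close> on multiples of \<open>E\<close> gives
  \<open>\<langle>E r, E p\<rangle> = 0\<close> for all scalar polynomials \<open>p\<close>; the choice \<open>p = r\<close> and definiteness give \<open>r = 0\<close>.\<close>
lemma scalar_part_real:
  fixes A J :: "'n cmat" and i0 :: 'n and c :: real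
  defines "S q \<equiv> mconst A ** xpoly - mconst J + mat q"
  assumes A: "\<And>j. A $ i0 $ j = 0"
    and J: "\<And>j. J $ i0 $ j = (if j = i0 then of_real c else 0)"
    and sym: "\<And>Q R. mip W (Q ** S q) R = mip W Q (R ** S q)"
  shows "map_poly cnj q = q"
proof -
  define E :: "'n cmat" where "E = (\<chi> i j. if i = i0 \<and> j = i0 then 1 else 0)"
  define q' where "q' = q - [:of_real c:]"
  define r where "r = q' - map_poly cnj q'"
  have "E ** A = 0"
    by (simp add: E_def vec_eq_iff matrix_matrix_mult_def A if_distrib[of "\<lambda>x. x * _"] cong: if_cong)
  have "E ** J = mat (of_real c) ** E"
    by (auto simp: vec_eq_iff mat_mult_nth) (auto simp: E_def matrix_matrix_mult_def J if_distrib[of "\<lambda>x. x * _"] cong: if_cong)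
  then have "mconst E ** S q = mconst E ** mat q'"
    unfolding S_def q'_def matrix_algebra mat_diff matrix_mul_assoc mconst_mult[symmetric] \<open>E ** A = 0\<close>
    by (simp add: mconst_mult mconst_mat mat_mult_commute)
  then have ES: "mconst E ** mat p ** S q = mconst E ** mat p ** mat q'" for p
    by (metis mat_mult_commute matrix_mul_assoc)
  have swap: "mip W (mconst E ** mat q') (mconst E ** mat r)
      = mip W (mconst E ** mat (map_poly cnj q')) (mconst E ** mat r)"
    using sym[of "mconst E ** mat 1" "mconst E ** mat r"]
    unfolding ES mip_mat_right[of W _ _ q'] by simp
  have Er_split: "mconst E ** mat r = mconst E ** mat q' - mconst E ** mat (map_poly cnj q')"
    by (simp add: r_def mat_diff matrix_diff_ldistrib)
  have "mip W (mconst E ** mat r) (mconst E ** mat r) = 0"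
    by (subst Er_split) (simp only: mip_diff_left swap diff_self)
  then have "mconst E ** mat r = 0" by (rule mip_definite)
  then have "(mconst E ** mat r) $ i0 $ i0 = 0" by simp
  then have "r = 0" by (simp add: mult_mat_nth mconst_def E_def)
  then have q': "map_poly cnj q' = q'"
    unfolding r_def by simp
  have "cnj (coeff q n) = coeff q n" for n
    using arg_cong[OF q', of "\<lambda>p. coeff p n"]
    by (cases n) (simp_all add: q'_def coeff_map_poly)
  then show ?thesis
    by (simp add: poly_eq_iff coeff_map_poly)
qed

end

section \<open>First rows of the structure matrices\<close>

lemma card_atMost_eq_1:
  fixes j :: "'n::{finite,linorder}"
  shows "card {..j} = 1 \<longleftrightarrow> j = Min UNIV"
proof
  assume "card {..j} = 1"
  then obtain x where x: "{..j} = {x}" by (auto simp: card_1_singleton_iff)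
  have "Min UNIV \<in> {..j}" "j \<in> {..j}" by auto
  then show "j = Min UNIV" unfolding x by simp
next
  assume "j = Min UNIV"
  then have "{..j} = {j}" by (auto intro!: antisym)
  then show "card {..j} = 1" by simp
qed

lemma A_mat_first_row: "A_mat a $ (Min UNIV) $ j = 0"
proof -
  have "card {..Min UNIV :: 'a} = 1" by (simp only: card_atMost_eq_1)
  then show ?thesis by (simp add: A_mat_def mat_unit_def)
qed

lemma J_mat_first_row: "J_mat $ (Min UNIV) $ j = (if j = Min UNIV then of_real 1 else 0)"
proof -
  have one: "card {..Min UNIV :: 'a} = 1" by (simp only: card_atMost_eq_1)
  have "(J_mat :: 'a cmat) $ (Min UNIV) $ j
      = (\<Sum>k=1..CARD('a). if k = 1 then (if card {..j} = 1 then 1 else 0) else 0)"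
    unfolding J_mat_def sum_component mat_unit_def by (intro sum.cong refl) (auto simp: one)
  also have "\<dots> = (if card {..j} = 1 then 1 else 0)"
    by (subst sum.delta) (auto simp: Suc_le_eq)
  finally show ?thesis unfolding card_atMost_eq_1 by simp
qed

section \<open>The difference operator attached to the differential operator\<close>

lemma shiftop_act_eq_sum:
  assumes "\<And>i. 1 < i \<Longrightarrow> S i n = 0"
  shows "shiftop_act S P n = (\<Sum>m<n+2. mconst (S (int m - int n) n) ** P m)"
proof -
  have bound: "i < 2" if "S i n \<noteq> 0" for i
    using assms[of i] that by (cases "1 < i") auto
  have "shiftop_act S P n
      = (\<Sum>m | m < n + 2 \<and> S (int m - int n) n \<noteq> 0. mconst (S (int m - int n) n) ** P m)"
    unfolding shiftop_act_def
    by (rule sum.reindex_bij_witness[where i = "\<lambda>m. int m - int n" and j = "\<lambda>i. nat (int n + i)"])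
       (auto simp: nat_less_iff dest: bound)
  also have "\<dots> = (\<Sum>m<n+2. mconst (S (int m - int n) n) ** P m)"
    by (rule sum.mono_neutral_left) auto
  finally show ?thesis .
qed

theorem theorem3p4:
  fixes a \<delta> :: "nat \<Rightarrow> real" and \<nu> :: real and \<phi> :: "complex \<Rightarrow> complex"
    and W :: "real \<Rightarrow> ('n::{finite,linorder}) cmat"
    and A :: "'n cmat" and D C :: "'n diffop"
    and v :: "complex poly" and k :: nat
    and P :: "nat \<Rightarrow> 'n mpoly" and X Y B :: "nat \<Rightarrow> 'n cmat"
    and Ac M :: "'n shiftop"
  assumes "0 < \<nu>"
    and "\<phi> analytic_on (complex_of_real ` {0..})"
    and "\<forall>x\<ge>0. \<phi> (complex_of_real x) \<in> \<real>"
    and "\<forall>i\<in>{1..CARD('n)}. 0 < \<delta> i"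
    and W: "W = W_weight a \<nu> \<phi> \<delta>"
    and "finite_moments W"
    and "vanishes_at_ends W"
    and A: "A = A_mat a"
    and D: "D = monom xpoly 1 + monom (mconst (A - mat 1) ** xpoly) 0"
    and C: "C = monom (mconst A ** xpoly - mconst J_mat) 0"
    and "degree v = k"
    and "is_adjoint W D (- D + C + monom (mat (pderiv v)) 0)"
    and "monic_orthogonal W P"
    and X: "X = X_coeff P" and Y: "Y = Y_coeff P" and B: "B = B_coeff P"
    and A1: "\<forall>n. Ac 1 n = A - mat 1"
    and A0: "\<forall>n. Ac 0 n = mat (of_nat n) + X n ** A - A ** X (n + 1) - B n"
    and Am1: "\<forall>n. Ac (-1) n = mat (of_nat n - 1) ** X n + Y n ** (A - mat 1)
                 - (A - mat 1) ** Y (n + 1) - Ac 0 n ** X n"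
    and Aj: "\<forall>j n. 1 - int k \<le> j \<and> j < -1 \<longrightarrow> Ac j n = shiftop_poly (pderiv v) (L_op W P) j n"
    and M: "M = (\<lambda>j n. if min (1 - int k) (-1) \<le> j \<and> j \<le> 1 then Ac j n else 0)"
  shows "\<forall>n. diffop_act (P n) D = shiftop_act M P n"
proof
  interpret monic_orthogonal_sequence W P
    using \<open>finite_moments W\<close> \<open>monic_orthogonal W P\<close> by unfold_locales
  define D' where "D' = - D + C + monom (mat (pderiv v)) 0"
  define S where "S = mconst A ** xpoly - mconst J_mat + mat (pderiv v)"
  have act_D: "diffop_act Q D = mderiv Q ** xpoly + Q ** mconst (A - mat 1) ** xpoly" for Q
    unfolding D diffop_act_order_1 by (simp add: matrix_mul_assoc)
  have "D' = monom (- xpoly) 1 + monom (S - mconst (A - mat 1) ** xpoly) 0"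
    unfolding D'_def D C S_def
    by (rule poly_eqI) simp
  then have act_D': "diffop_act Q D' = Q ** S - diffop_act Q D" for Q
    unfolding act_D by (simp only: diffop_act_order_1 matrix_algebra matrix_mul_assoc) (simp add: algebra_simps)
  have adjoint: "mip W (diffop_act Q D) R = mip W Q (diffop_act R D')" for Q R
    using \<open>is_adjoint W D (- D + C + monom (mat (pderiv v)) 0)\<close>
    unfolding is_adjoint_def D'_def by blast
  \<comment> \<open>\<open>D + D\<^sup>\<dagger>\<close> is symmetric, and its derivatives cancel: it is the multiplication by \<open>S\<close>.\<close>
  have "mip W (Q ** S) R = mip W Q (R ** S)" for Q R
  proof -
    have "mip W (diffop_act Q D') R = mip W Q (diffop_act R D)"
      by (subst (1 2) mstar_mip[symmetric]) (simp only: adjoint)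
    moreover have "Q ** S = diffop_act Q D + diffop_act Q D'" for Q
      by (simp add: act_D')
    ultimately show ?thesis
      by (simp only: mip_add_left mip_add_right adjoint add.commute)
  qed
  then have real: "map_poly cnj (pderiv v) = pderiv v"
    unfolding S_def A
    by (rule scalar_part_real[OF A_mat_first_row J_mat_first_row])
  fix n
  define Q where "Q = diffop_act (P n) D"
  have degree_Q: "degree_below (n + 2) Q"
    unfolding Q_def act_D
    using degree_below_mderiv_xpoly[OF P_degree[of n]]
      degree_below_xpoly[OF degree_below_mconst_right[OF P_degree[of n]]]
    by (auto intro!: degree_below_add intro: degree_below_mono)
  have coeff_Q: "mcoeff Q m = mat (of_int m) ** mcoeff (P n) m + mcoeff (P n) (m - 1) ** (A - mat 1)" for m
    unfolding Q_def act_D mcoeff_add mcoeff_mderiv_xpoly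
    by (simp add: mcoeff_xpoly mcoeff_mconst_right)
  have low: "mip W Q (P m) = M (int m - int n) n ** H m" if "m < n - 1" for m
  proof -
    define R where "R = P m ** (mconst A ** xpoly - mconst J_mat) - diffop_act (P m) D"
    have d1: "degree_below (Suc (Suc m)) (mderiv (P m) ** xpoly)"
      by (rule degree_below_mono[OF degree_below_mderiv_xpoly[OF P_degree]]) simp
    have d2: "degree_below (Suc (Suc m)) (P m ** mconst K)" for K
      by (rule degree_below_mono[OF degree_below_mconst_right[OF P_degree]]) simp
    have d3: "degree_below (Suc (Suc m)) (P m ** mconst K ** xpoly)" for K
      by (intro degree_below_xpoly degree_below_mconst_right P_degree)
    have "degree_below (Suc (Suc m)) R"
      unfolding R_def act_D matrix_diff_ldistrib matrix_mul_assoc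
      by (intro degree_below_diff degree_below_add d1 d2 d3)
    \<comment> \<open>\<open>R\<close> is \<open>P(m) \<cdot> (- D + C)\<close>.\<close>
    then have "mip W (P n) R = 0"
      using that by (intro mip_P_low) (auto intro: degree_below_mono)
    moreover have "diffop_act (P m) D' = R + P m ** mat (pderiv v)"
      unfolding act_D' R_def S_def by (simp add: matrix_algebra)
    ultimately have eq: "mip W Q (P m) = mip W (P n) (P m ** mat (pderiv v))"
      unfolding Q_def adjoint by (simp add: mip_add_right)
    show ?thesis
    proof (cases "1 - int k \<le> int m - int n")
      case True
      have "M (int m - int n) n = shiftop_poly (pderiv v) (L_op W P) (int m - int n) n"
        using True that Aj by (simp add: M)
      then show ?thesis
        unfolding eq mip_mat_right real mip_shiftop_poly by simp
    next
      case False
      have "degree_below (Suc m + (k - 1)) (P m ** mat (pderiv v))"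
        using \<open>degree v = k\<close> by (intro degree_below_mat P_degree) (simp add: degree_pderiv)
      then have "degree_below n (P m ** mat (pderiv v))"
        by (rule degree_below_mono) (use False that in linarith)
      then show ?thesis
        using False that unfolding eq by (simp add: mip_P_low M)
    qed
  qed
  have M_Ac: "M 1 n = Ac 1 n" "M 0 n = Ac 0 n" "M (-1) n = Ac (-1) n"
    by (auto simp: M)
  \<comment> \<open>Subtracting the three top terms lowers the degree below \<open>n - 1\<close>, and the rest is determined by its inner
    products.  For \<open>n = 0\<close> truncated subtraction turns this bound into \<open>R = 0\<close>.\<close>
  define T where "T = (if n = 0 then 0 else mconst (Ac (-1) n) ** P (n - 1))"
  define R where "R = Q - mconst (Ac 1 n) ** P (n + 1) - mconst (Ac 0 n) ** P n - T"
  have degree_T: "degree_below n T"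
    using degree_below_mconst_left[OF P_degree[of "n - 1"]] by (cases n) (auto simp: T_def)
  have P_high: "mcoeff (P n) (int n + 1) = 0"
    using P_degree[of n] by (simp add: degree_below_def)
  have P_monic': "mcoeff (P (n + 1)) (int n + 1) = mat 1"
    using P_monic[of "n + 1"] by (simp add: add.commute)
  have "degree_below (n + 2) R"
    unfolding R_def
    using degree_below_mono[OF degree_T, of "n + 2"] degree_below_mono[OF P_degree[of n], of "n + 2"]
      P_degree[of "n + 1"]
    by (intro degree_below_diff degree_below_mconst_left degree_Q) auto
  moreover have "mcoeff R (int n + 1) = 0"
    using degree_T
    by (simp add: R_def mcoeff_diff mcoeff_mconst_left coeff_Q P_high P_monic P_monic'[simplified] A1 degree_below_def)
  ultimately have "degree_below (Suc n) R"
    using degree_below_Suc[of "Suc n" R] by (simp add: add.commute)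
  moreover have "mcoeff R (int n) = 0"
    using degree_T
    unfolding R_def mcoeff_diff mcoeff_mconst_left coeff_Q A0[rule_format] A1[rule_format] X B
      X_coeff_def B_coeff_def degree_below_def
    by (simp add: P_monic matrix_algebra)
  ultimately have R_n: "degree_below n R" by (rule degree_below_Suc)
  have "degree_below (n - 1) R"
  proof (cases n)
    case 0
    then show ?thesis using R_n by simp
  next
    case (Suc l)
    then have n1: "int n - 1 = int l" "int (n + 1) - 2 = int l" "int n - 2 = int l - 1" by auto
    have T_l: "mcoeff T (int l) = Ac (-1) n"
      using P_monic[of l] by (simp add: T_def mcoeff_mconst_left Suc)
    have "mcoeff R (int l) = 0"
      unfolding R_def mcoeff_diff mcoeff_mconst_left coeff_Q T_l Am1[rule_format] A1[rule_format] X Y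
        X_coeff_def Y_coeff_def n1
      by (simp add: Suc)
    then show ?thesis using R_n Suc by (simp add: degree_below_Suc)
  qed
  moreover have "mip W R (P m) = M (int m - int n) n ** H m" if "m < n - 1" for m
    using that low[OF that] by (auto simp: R_def T_def mip_diff_left mip_mconst_left mip_P)
  ultimately have "R = (\<Sum>m<n-1. mconst (M (int m - int n) n) ** P m)"
    by (rule expansion_eqI)
  then have "Q = (\<Sum>m<n-1. mconst (M (int m - int n) n) ** P m) + T
      + mconst (M 0 n) ** P n + mconst (M 1 n) ** P (n + 1)"
    unfolding R_def M_Ac by (simp add: algebra_simps)
  also have "\<dots> = (\<Sum>m<n+2. mconst (M (int m - int n) n) ** P m)"
    unfolding T_def M_Ac(3)[symmetric] by (cases n) simp_all
  also have "\<dots> = shiftop_act M P n"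
    by (rule shiftop_act_eq_sum[symmetric]) (simp add: M)
  finally show "diffop_act (P n) D = shiftop_act M P n" unfolding Q_def .
qed

end
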